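(* Let $t$, $m$ and $k$ be non-negative integers. The following three sets are pairwise in bijection: (a) the set of $t$-core partitions with $m$ corners such that $h(1,1)<kt$; (b) the set of non-negative integer sequences $(n_0,n_1,\dots,n_{t-1})$ such that $n_0=0$, $n_i\le k$ for all $i$, and $\sum_{i=1}^{t}|n_i-n_{i-1}|=2m$, where one sets $n_t:=0$; (c) the set of cornerless Motzkin paths of length $2m+t-1$ with exactly $t-1$ flat steps that are contained in the strip $0\le y\le k$.
   Context: A partition $\lambda=(\lambda_1,\dots,\lambda_\ell)$ is a non-increasing sequence of positive integers; its Young diagram has $\lambda_i$ left-justified boxes in row $i$. An inner corner is a box whose removal leaves the Young diagram of a partition; $\lambda$ has $m$ corners if its Young diagram has exactly $m$ inner corners. The hook length $h(i,j)$ of the box in position $(i,j)$ is the number of boxes to its right in its row, below it in its column, plus one (the box itself). A partition is a $t$-core if no box of its Young diagram has hook length $t$. (For the empty partition, which has no box $(1,1)$, the condition $h(1,1)<kt$ is regarded as satisfied.) A Motzkin path of length $n$ is a path from $(0,0)$ to $(n,0)$ with steps $u=(1,1)$, $d=(1,-1)$, $f=(1,0)$ staying weakly above the $x$-axis. A peak is a vertex preceded by an up step and followed by a down step; a valley is a vertex preceded by a down step and followed by an up step; a path is cornerless if it has no peaks and no valleys. *)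

theory Defs
  imports Main "HOL-Library.Product_Plus"
begin

definition partitions :: "nat list set" where
  "partitions = {xs. sorted_wrt (\<ge>) xs \<and> (\<forall>x\<in>set xs. 0 < x)}"

text \<open>Boxes are addressed as (row, column), both counted from 1.\<close>

definition young :: "nat list \<Rightarrow> (nat \<times> nat) set" where
  "young xs = {(i, j). 1 \<le> i \<and> i \<le> length xs \<and> 1 \<le> j \<and> j \<le> xs ! (i - 1)}"

definition inner_corners :: "nat list \<Rightarrow> (nat \<times> nat) set" where
  "inner_corners xs = {b \<in> young xs. \<exists>ys\<in>partitions. young ys = young xs - {b}}"

definition hook_length :: "nat list \<Rightarrow> nat \<times> nat \<Rightarrow> nat" where
  "hook_length xs = (\<lambda>(i, j).
     card {j'. j < j' \<and> (i, j') \<in> young xs} + card {i'. i < i' \<and> (i', j) \<in> young xs} + 1)"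

definition is_core :: "nat \<Rightarrow> nat list \<Rightarrow> bool" where
  "is_core t xs \<longleftrightarrow> (\<forall>b\<in>young xs. hook_length xs b \<noteq> t)"

text \<open>The premise on the box (1, 1) makes the hook bound hold vacuously for the empty partition.\<close>

definition core_partitions :: "nat \<Rightarrow> nat \<Rightarrow> nat \<Rightarrow> nat list set" where
  "core_partitions t m k = {xs \<in> partitions. is_core t xs \<and> card (inner_corners xs) = m \<and>
     ((1, 1) \<in> young xs \<longrightarrow> hook_length xs (1, 1) < k * t)}"

text \<open>A sequence indexed by 0, ..., t - 1 is a list of length t; appending a final 0 encodes
  the convention that its value at t is 0.\<close>

definition sequences :: "nat \<Rightarrow> nat \<Rightarrow> nat \<Rightarrow> nat list set" where
  "sequences t m k = {ns. length ns = t \<and>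
     (let n = (\<lambda>i. (ns @ [0]) ! i) in
        n 0 = 0 \<and> (\<forall>i<t. n i \<le> k) \<and>
        (\<Sum>i=1..t. \<bar>int (n i) - int (n (i - 1))\<bar>) = 2 * int m)}"

datatype step = Up | Down | Flat

fun step_vec :: "step \<Rightarrow> int \<times> int" where
  "step_vec Up = (1, 1)"
| "step_vec Down = (1, -1)"
| "step_vec Flat = (1, 0)"

text \<open>A path is the list of its steps; \<open>vertex p i\<close> is the point reached after \<open>i\<close> steps
  from the origin, for \<open>i \<le> length p\<close>.\<close>

definition vertex :: "step list \<Rightarrow> nat \<Rightarrow> int \<times> int" where
  "vertex p i = sum_list (map step_vec (take i p))"

definition motzkin_paths :: "nat \<Rightarrow> step list set" where
  "motzkin_paths n = {p. vertex p (length p) = (int n, 0) \<and>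
     (\<forall>i\<le>length p. 0 \<le> snd (vertex p i))}"

text \<open>\<open>p ! i\<close> and \<open>p ! Suc i\<close> are the steps into and out of \<open>vertex p (Suc i)\<close>.\<close>

definition has_peak :: "step list \<Rightarrow> bool" where
  "has_peak p \<longleftrightarrow> (\<exists>i. Suc i < length p \<and> p ! i = Up \<and> p ! Suc i = Down)"

definition has_valley :: "step list \<Rightarrow> bool" where
  "has_valley p \<longleftrightarrow> (\<exists>i. Suc i < length p \<and> p ! i = Down \<and> p ! Suc i = Up)"

definition cornerless :: "step list \<Rightarrow> bool" where
  "cornerless p \<longleftrightarrow> \<not> has_peak p \<and> \<not> has_valley p"

text \<open>Since the strip is convex, it contains a path as soon as it contains its vertices.\<close>

definition in_strip :: "nat \<Rightarrow> step list \<Rightarrow> bool" where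
  "in_strip k p \<longleftrightarrow> (\<forall>i\<le>length p. 0 \<le> snd (vertex p i) \<and> snd (vertex p i) \<le> int k)"

text \<open>Subtraction on \<open>nat\<close> is truncated, which matters only for \<open>t = 0\<close>: there a number
  \<open>t - 1\<close> of flat steps has no literal meaning, and truncation keeps the empty path for
  \<open>m = 0\<close> and no path for \<open>m > 0\<close>.\<close>

definition strip_paths :: "nat \<Rightarrow> nat \<Rightarrow> nat \<Rightarrow> step list set" where
  "strip_paths t m k = {p \<in> motzkin_paths (2 * m + t - 1).
     cornerless p \<and> count_list p Flat = t - 1 \<and> in_strip k p}"

end

theory Submission
  imports Defs
begin

text \<open>A partition is encoded by the set of its first-column hook lengths, an arbitrary finite
  set \<open>X\<close> of positive integers. Boxes of hook length \<open>t\<close> correspond to elements \<open>x \<ge> t\<close> of \<open>X\<close> with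
  \<open>x - t \<notin> X\<close>, and inner corners to elements \<open>x\<close> with \<open>x - 1 \<notin> X\<close>. Hence for a \<open>t\<close>-core the set \<open>X\<close> meets
  the residue class of \<open>i\<close> in \<open>i, i + t, \<dots>, i + (n\<^sub>i - 1) t\<close>, which gives the sequence; the
  number of corners is the sum of the positive parts of the differences \<open>n\<^sub>i - n\<^sub>i\<^sub>-\<^sub>1\<close>, that is half
  of their total variation. The path moves vertically from \<open>n\<^sub>i\<^sub>-\<^sub>1\<close> to \<open>n\<^sub>i\<close> and separates
  these monotone blocks by flat steps.\<close>

section \<open>Partitions and first-column hook lengths\<close>

text \<open>For a partition, \<open>x + length xs\<close> is the hook length of the box (1, 1):
  \<open>x\<close> boxes in its row and, all parts being positive, \<open>length xs\<close> below
  it. Deleting the first row changes no hook further down, whence the recursion.\<close>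

fun first_hooks :: "nat list \<Rightarrow> nat set" where
  "first_hooks [] = {}"
| "first_hooks (x # xs) = insert (x + length xs) (first_hooks xs)"

text \<open>For a partition, these are the non-negative integers outside
  \<open>first_hooks xs\<close> in increasing order. In the boundary word of the diagram, read from
  the bottom left, \<open>gap xs j\<close> is the position of the horizontal step under column
  \<open>j + 1\<close>: it comes after \<open>j\<close> horizontal steps and one vertical step for
  each row of length at most \<open>j\<close>.\<close>

definition gap :: "nat list \<Rightarrow> nat \<Rightarrow> nat" where
  "gap xs j = j + length (filter (\<lambda>y. y \<le> j) xs)"

section \<open>Elementary facts on partitions and Young diagrams\<close>

lemma Nil_partitions [simp]: "[] \<in> partitions"
  by (simp add: partitions_def)

lemma Cons_partitions:
  "x # xs \<in> partitions \<longleftrightarrow> 0 < x \<and> (\<forall>y\<in>set xs. y \<le> x) \<and> xs \<in> partitions"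
  by (auto simp: partitions_def)

lemma partitions_pos: "xs \<in> partitions \<Longrightarrow> y \<in> set xs \<Longrightarrow> 0 < y"
  by (auto simp: partitions_def)

lemma young_Nil [simp]: "young [] = {}"
  by (auto simp: young_def)

lemma young_0 [simp]: "(0, j) \<notin> young xs" "(i, 0) \<notin> young xs"
  by (auto simp: young_def)

lemma young_Cons_1 [simp]: "(Suc 0, j) \<in> young (x # xs) \<longleftrightarrow> 1 \<le> j \<and> j \<le> x"
  by (auto simp: young_def)

lemma young_Cons_Suc [simp]: "1 \<le> i \<Longrightarrow> (Suc i, j) \<in> young (x # xs) \<longleftrightarrow> (i, j) \<in> young xs"
  by (auto simp: young_def)

lemma young_Cons_iff:
  "(i, j) \<in> young (x # xs) \<longleftrightarrow>
     (i = 1 \<and> 1 \<le> j \<and> j \<le> x) \<or> (\<exists>i'. i = Suc i' \<and> (i', j) \<in> young xs)"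
proof (cases i)
  case (Suc n)
  then show ?thesis by (cases n) auto
qed simp

lemma young_first_row: "(1, y) \<in> young ys \<longleftrightarrow> ys \<noteq> [] \<and> 1 \<le> y \<and> y \<le> hd ys"
  by (cases ys) auto

lemma set_in_young:
  assumes "ys \<in> partitions" "y \<in> set ys"
  shows "\<exists>i\<ge>1. (i, y) \<in> young ys"
proof -
  obtain n where "n < length ys" "ys ! n = y"
    using assms(2) by (auto simp: in_set_conv_nth)
  then have "(Suc n, y) \<in> young ys"
    using partitions_pos[OF assms] by (auto simp: young_def)
  then show ?thesis by (intro exI[of _ "Suc n"]) simp
qed

lemma young_le:
  assumes "(i, y) \<in> young xs" "\<forall>z\<in>set xs. z \<le> x"
  shows "y \<le> x"
proof -
  have "xs ! (i - 1) \<in> set xs" "y \<le> xs ! (i - 1)"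
    using assms(1) by (auto simp: young_def)
  then show ?thesis using assms(2) by force
qed

lemma young_up_closed:
  assumes "xs \<in> partitions" "(Suc i, j) \<in> young xs" "1 \<le> i"
  shows "(i, j) \<in> young xs"
proof -
  have "xs ! i \<le> xs ! (i - 1)"
    using assms unfolding partitions_def young_def
    by (auto dest!: sorted_wrt_nth_less[where i = "i - 1" and j = i])
  then show ?thesis using assms by (auto simp: young_def)
qed

lemma young_left_closed: "(i, Suc j) \<in> young xs \<Longrightarrow> 1 \<le> j \<Longrightarrow> (i, j) \<in> young xs"
  by (auto simp: young_def)

section \<open>Hook lengths and gaps\<close>

lemma column_height:
  assumes "1 \<le> j"
  shows "card {i. (i, j) \<in> young xs} = length (filter (\<lambda>y. j \<le> y) xs)"
proof -
  have "{i. (i, j) \<in> young xs} = Suc ` {i. i < length xs \<and> j \<le> xs ! i}"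
  proof (intro set_eqI iffI)
    fix i assume "i \<in> {i. (i, j) \<in> young xs}"
    then show "i \<in> Suc ` {i. i < length xs \<and> j \<le> xs ! i}"
      by (cases i) (auto simp: young_def)
  qed (use assms in \<open>auto simp: young_def\<close>)
  then show ?thesis
    by (simp add: length_filter_conv_card card_image)
qed

lemma hook_length_Cons_Suc:
  assumes "1 \<le> i"
  shows "hook_length (x # xs) (Suc i, j) = hook_length xs (i, j)"
proof -
  have "{i'. Suc i < i' \<and> (i', j) \<in> young (x # xs)} = Suc ` {i'. i < i' \<and> (i', j) \<in> young xs}"
    using assms by (auto simp: young_Cons_iff)
  then show ?thesis
    using assms by (simp add: hook_length_def card_image)
qed

text \<open>The leg counts the rows of \<open>xs\<close> of length at least \<open>j\<close>, the
  gap those of length less than \<open>j\<close>; together they give \<open>length xs\<close>, and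
  the remaining terms \<open>x - j\<close>, \<open>1\<close> and \<open>j - 1\<close> give
  \<open>x\<close>. So the hook lengths of the first row are differences between its first hook and
  gaps.\<close>

lemma hook_length_first_row:
  assumes "1 \<le> j" "j \<le> x"
  shows "hook_length (x # xs) (1, j) + gap xs (j - 1) = x + length xs"
proof -
  have "{i'. 1 < i' \<and> (i', j) \<in> young (x # xs)} = Suc ` {i. (i, j) \<in> young xs}"
    using assms by (auto simp: young_Cons_iff gr0_conv_Suc) (metis not0_implies_Suc young_0(1))
  then have leg: "card {i'. 1 < i' \<and> (i', j) \<in> young (x # xs)} = length (filter (\<lambda>y. j \<le> y) xs)"
    using column_height[OF assms(1)] by (simp add: card_image)
  have "{j'. j < j' \<and> (1, j') \<in> young (x # xs)} = {j<..x}"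
    by auto
  then have arm: "card {j'. j < j' \<and> (1, j') \<in> young (x # xs)} = x - j"
    by simp
  have "(\<lambda>y. y \<le> j - 1) = (\<lambda>y. \<not> j \<le> y)"
    using assms by auto
  then have "length (filter (\<lambda>y. j \<le> y) xs) + length (filter (\<lambda>y. y \<le> j - 1) xs) = length xs"
    using sum_length_filter_compl[of "\<lambda>y. j \<le> y" xs] by simp
  then show ?thesis
    using assms arm leg by (simp add: hook_length_def gap_def)
qed

lemma gap_strict_mono:
  assumes "i < j"
  shows "gap xs i < gap xs j"
proof -
  have "length (filter (\<lambda>y. y \<le> i) xs) \<le> length (filter (\<lambda>y. y \<le> j) xs)"
    using assms by (induction xs) auto
  then show ?thesis using assms by (simp add: gap_def)
qed

lemma gap_large: "\<forall>y\<in>set xs. y \<le> j \<Longrightarrow> gap xs j = j + length xs"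
  by (simp add: gap_def)

text \<open>By \<open>gap_large\<close> the value at \<open>x\<close> is exactly
  \<open>x + length xs\<close>; the rest is strict monotonicity.\<close>

lemma gap_less_iff:
  assumes "\<forall>y\<in>set xs. y \<le> x"
  shows "gap xs j < x + length xs \<longleftrightarrow> j < x"
  using gap_large[OF assms] gap_strict_mono[of j x xs] gap_strict_mono[of x j xs]
  by (metis less_asym less_irrefl nat_neq_iff)

text \<open>A longest row put on top leaves the gaps with index below \<open>x\<close> unchanged and
  turns \<open>gap xs (Suc j)\<close> into the gap with index \<open>j\<close> for
  \<open>j \<ge> x\<close>. Exactly the value \<open>gap xs x = x + length xs\<close> is lost, and
  this is the new first-column hook.\<close>

lemma range_gap: "xs \<in> partitions \<Longrightarrow> range (gap xs) = - first_hooks xs"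
proof (induction xs)
  case Nil
  then show ?case by (auto simp: gap_def)
next
  case (Cons x xs)
  then have le: "\<forall>y\<in>set xs. y \<le> x" and IH: "range (gap xs) = - first_hooks xs"
    by (auto simp: Cons_partitions)
  have small: "gap (x # xs) j = gap xs j" if "j < x" for j
    using that by (simp add: gap_def)
  have large: "gap (x # xs) j = Suc (j + length xs)" "gap xs j = j + length xs" if "x \<le> j" for j
  proof -
    have "\<forall>y\<in>set (x # xs). y \<le> j" using that le by auto
    then show "gap (x # xs) j = Suc (j + length xs)" "gap xs j = j + length xs"
      using gap_large[of "x # xs" j] gap_large[of xs j] by auto
  qed
  have "y \<in> range (gap (x # xs)) \<longleftrightarrow> y \<in> range (gap xs) \<and> y \<noteq> x + length xs" for y
  proof
    assume "y \<in> range (gap (x # xs))"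
    then obtain j where j: "y = gap (x # xs) j" by blast
    show "y \<in> range (gap xs) \<and> y \<noteq> x + length xs"
    proof (cases "j < x")
      case True
      then have "gap xs j < x + length xs"
        using gap_less_iff[OF le] by blast
      then show ?thesis using j small[OF True] by auto
    next
      case False
      then have "y = gap xs (Suc j)"
        using j large(1)[of j] large(2)[of "Suc j"] by simp
      then show ?thesis using j False large(1)[of j] by auto
    qed
  next
    assume y: "y \<in> range (gap xs) \<and> y \<noteq> x + length xs"
    then obtain j where j: "y = gap xs j" by blast
    show "y \<in> range (gap (x # xs))"
    proof (cases "j < x")
      case True
      then show ?thesis using j small by (metis rangeI)
    next
      case False
      then have "x < j" using y j large(2)[of j] by (cases "j = x") auto
      then have "y = gap (x # xs) (j - 1)"
        using j large(1)[of "j - 1"] large(2)[of j] by simp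
      then show ?thesis by blast
    qed
  qed
  then show ?case using IH by auto
qed

section \<open>Partitions as finite sets of positive integers\<close>

lemma first_hooks_less: "\<forall>y\<in>set xs. y \<le> x \<Longrightarrow> b \<in> first_hooks xs \<Longrightarrow> b < x + length xs"
  by (induction xs) auto

lemma finite_first_hooks [simp]: "finite (first_hooks xs)"
  by (induction xs) auto

lemma card_first_hooks: "xs \<in> partitions \<Longrightarrow> card (first_hooks xs) = length xs"
proof (induction xs)
  case (Cons x xs)
  then have "x + length xs \<notin> first_hooks xs"
    using first_hooks_less[of xs x] by (auto simp: Cons_partitions)
  then show ?case using Cons by (simp add: Cons_partitions)
qed simp

lemma zero_notin_first_hooks: "xs \<in> partitions \<Longrightarrow> 0 \<notin> first_hooks xs"
  by (induction xs) (auto simp: Cons_partitions)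

lemma Max_first_hooks:
  assumes "x # xs \<in> partitions"
  shows "Max (first_hooks (x # xs)) = x + length xs"
  using assms first_hooks_less[of xs x]
  by (intro Max_eqI) (auto simp: Cons_partitions less_imp_le)

text \<open>The cardinality of the set gives the number of rows, its maximum then gives the first
  row, and without the maximum it is the set of the remaining rows.\<close>

lemma inj_on_first_hooks: "inj_on first_hooks partitions"
proof (rule inj_onI)
  fix xs ys
  show "xs \<in> partitions \<Longrightarrow> ys \<in> partitions \<Longrightarrow> first_hooks xs = first_hooks ys \<Longrightarrow> xs = ys"
  proof (induction xs arbitrary: ys)
    case Nil
    then show ?case by (cases ys) auto
  next
    case (Cons x xs)
    obtain y ys' where ys: "ys = y # ys'"
      using Cons.prems by (cases ys) auto
    have len: "length xs = length ys'"
      using Cons.prems card_first_hooks[of "x # xs"] card_first_hooks[of ys] ys by simp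
    have x: "x = y"
      using Cons.prems len Max_first_hooks[of x xs] Max_first_hooks[of y ys'] ys by simp
    have "x + length xs \<notin> first_hooks xs" "x + length xs \<notin> first_hooks ys'"
      using Cons.prems len x ys first_hooks_less[of xs x] first_hooks_less[of ys' x]
      by (auto simp: Cons_partitions)
    then have "first_hooks xs = first_hooks ys'"
      using Cons.prems(3) ys len x by (simp add: insert_ident)
    then show ?case
      using Cons ys x by (auto simp: Cons_partitions)
  qed
qed

lemma first_hooks_surj:
  assumes "finite X" "0 \<notin> X"
  shows "\<exists>xs\<in>partitions. first_hooks xs = X"
  using assms
proof (induction X rule: finite_linorder_max_induct)
  case empty
  then show ?case by (intro bexI[of _ "[]"]) auto
next
  case (insert b A)
  then obtain xs where xs: "xs \<in> partitions" "first_hooks xs = A"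
    by auto
  show ?case
  proof (cases xs)
    case Nil
    then have "[b] \<in> partitions" "first_hooks [b] = insert b A"
      using insert xs by (auto simp: Cons_partitions)
    then show ?thesis by blast
  next
    \<comment> \<open>Since \<open>b\<close> exceeds the largest hook \<open>y + length ys\<close>,
      the new top row \<open>b - length xs\<close> has length at least \<open>y\<close>.\<close>
    case (Cons y ys)
    then have "y + length ys < b"
      using insert xs by auto
    then have "(b - length xs) # xs \<in> partitions" "first_hooks ((b - length xs) # xs) = insert b A"
      using Cons xs by (auto simp: Cons_partitions)
    then show ?thesis by blast
  qed
qed

text \<open>By \<open>hook_length_first_row\<close> and \<open>range_gap\<close>, the first row has
  a hook of length \<open>t\<close> iff \<open>t \<le> ?b\<close> and \<open>?b - t\<close> is
  missing from \<open>first_hooks xs\<close>. The rows below are handled by induction.\<close>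

lemma is_core_iff:
  assumes "1 \<le> t"
  shows "xs \<in> partitions \<Longrightarrow>
    is_core t xs \<longleftrightarrow> (\<forall>b\<in>first_hooks xs. t \<le> b \<longrightarrow> b - t \<in> first_hooks xs)"
proof (induction xs)
  case Nil
  then show ?case by (simp add: is_core_def)
next
  case (Cons x xs)
  let ?b = "x + length xs"
  have le: "\<forall>y\<in>set xs. y \<le> x" and xs: "xs \<in> partitions"
    using Cons.prems by (auto simp: Cons_partitions)
  have rows: "is_core t (x # xs) \<longleftrightarrow>
      is_core t xs \<and> (\<forall>j. 1 \<le> j \<and> j \<le> x \<longrightarrow> hook_length (x # xs) (1, j) \<noteq> t)"
  proof
    assume core: "is_core t (x # xs)"
    have "hook_length xs (i, j) \<noteq> t" if "(i, j) \<in> young xs" for i j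
    proof -
      have "1 \<le> i" using that by (cases i) auto
      then show ?thesis
        using that core hook_length_Cons_Suc[of i x xs j] unfolding is_core_def
        by (metis young_Cons_Suc)
    qed
    then show "is_core t xs \<and> (\<forall>j. 1 \<le> j \<and> j \<le> x \<longrightarrow> hook_length (x # xs) (1, j) \<noteq> t)"
      using core unfolding is_core_def by auto
  next
    assume R: "is_core t xs \<and> (\<forall>j. 1 \<le> j \<and> j \<le> x \<longrightarrow> hook_length (x # xs) (1, j) \<noteq> t)"
    have "hook_length (x # xs) (i, j) \<noteq> t" if ij: "(i, j) \<in> young (x # xs)" for i j
      using ij unfolding young_Cons_iff
    proof (elim disjE exE conjE)
      fix i' assume i: "i = Suc i'" "(i', j) \<in> young xs"
      then have "1 \<le> i'" by (cases i') auto
      then show ?thesis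
        using i R by (auto simp: is_core_def hook_length_Cons_Suc)
    qed (use R in auto)
    then show "is_core t (x # xs)" by (auto simp: is_core_def)
  qed
  have "(\<exists>j. 1 \<le> j \<and> j \<le> x \<and> hook_length (x # xs) (1, j) = t) \<longleftrightarrow>
      t \<le> ?b \<and> ?b - t \<in> range (gap xs)"
  proof
    assume "\<exists>j. 1 \<le> j \<and> j \<le> x \<and> hook_length (x # xs) (1, j) = t"
    then obtain j where "1 \<le> j" "j \<le> x" "hook_length (x # xs) (1, j) = t" by blast
    then have "t + gap xs (j - 1) = ?b"
      using hook_length_first_row by blast
    then have "t \<le> ?b" "?b - t = gap xs (j - 1)" by linarith+
    then show "t \<le> ?b \<and> ?b - t \<in> range (gap xs)" by auto
  next
    assume "t \<le> ?b \<and> ?b - t \<in> range (gap xs)"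
    then obtain j where j: "t \<le> ?b" "?b - t = gap xs j" by blast
    \<comment> \<open>As \<open>t \<ge> 1\<close>, the gap lies strictly below \<open>?b\<close>, so
      its column meets the first row.\<close>
    then have "j < x"
      using gap_less_iff[OF le, of j] assms by linarith
    then have "hook_length (x # xs) (1, Suc j) = t"
      using hook_length_first_row[of "Suc j" x xs] j by simp
    then show "\<exists>j. 1 \<le> j \<and> j \<le> x \<and> hook_length (x # xs) (1, j) = t"
      using \<open>j < x\<close> by (intro exI[of _ "Suc j"]) auto
  qed
  then have first: "(\<forall>j. 1 \<le> j \<and> j \<le> x \<longrightarrow> hook_length (x # xs) (1, j) \<noteq> t) \<longleftrightarrow>
      (t \<le> ?b \<longrightarrow> ?b - t \<in> first_hooks xs)"
    using range_gap[OF xs] by auto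
  \<comment> \<open>No difference \<open>b - t\<close> equals the new element \<open>?b\<close>, so
    membership in \<open>first_hooks xs\<close> and in \<open>first_hooks (x # xs)\<close> agree for
    it.\<close>
  have "?b - t \<noteq> ?b" if "t \<le> ?b"
    using that assms by linarith
  moreover have "b - t \<noteq> ?b" if "b \<in> first_hooks xs" for b
    using first_hooks_less[OF le that] by linarith
  ultimately show ?case
    unfolding rows first Cons.IH[OF xs] by auto
qed

section \<open>Inner corners\<close>

lemma inner_cornersI:
  "xs \<in> partitions \<Longrightarrow> (i, j) \<in> young xs \<Longrightarrow> (Suc i, j) \<notin> young xs \<Longrightarrow> (i, Suc j) \<notin> young xs \<Longrightarrow>
    \<exists>ys\<in>partitions. young ys = young xs - {(i, j)}"
proof (induction xs arbitrary: i)
  case Nil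
  then show ?case by simp
next
  case (Cons x xs)
  have le: "\<forall>y\<in>set xs. y \<le> x" and xs: "xs \<in> partitions" and x: "0 < x"
    using Cons.prems by (auto simp: Cons_partitions)
  obtain i' where i': "i = Suc i'"
    using Cons.prems(2) by (cases i) auto
  consider "i' = 0" | "1 \<le> i'" by linarith
  then show ?case
  proof cases
    case 1
    have j: "j = x" using 1 i' Cons.prems by auto
    \<comment> \<open>The box below the end of the first row is absent, so the next row is shorter,
      and with it all later ones. Hence the first row can lose a box.\<close>
    have less: "\<forall>y\<in>set xs. y < x"
    proof
      fix y assume y: "y \<in> set xs"
      then obtain z zs where "xs = z # zs" by (cases xs) auto
      then have "xs \<noteq> []" "y \<le> hd xs"
        using xs y by (auto simp: Cons_partitions)
      moreover have "(1, j) \<notin> young xs"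
        using Cons.prems(3) 1 i' by simp
      ultimately show "y < x"
        using x j young_first_row[of x xs] by auto
    qed
    show ?thesis
    proof (cases "x = 1")
      \<comment> \<open>A row of length 1 must vanish entirely, because parts are positive; it is
        then the only row.\<close>
      case True
      then have "xs = []"
        using less partitions_pos[OF xs] by (cases xs) auto
      then show ?thesis
        using True 1 i' j by (intro bexI[of _ "[]"]) (auto simp: young_Cons_iff)
    next
      case False
      then have "(x - 1) # xs \<in> partitions"
        using x xs less by (force simp: Cons_partitions)
      moreover have "young ((x - 1) # xs) = young (x # xs) - {(i, j)}"
        using 1 i' j by (auto simp: young_Cons_iff)
      ultimately show ?thesis by (rule bexI[rotated])
    qed
  next
    case 2
    obtain ys where ys: "ys \<in> partitions" "young ys = young xs - {(i', j)}"
      using Cons.IH[OF xs, of i'] Cons.prems 2 i' by auto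
    \<comment> \<open>Each part of \<open>ys\<close> is the column of a box of
      \<open>young ys\<close>, hence of \<open>young xs\<close>; so \<open>x\<close> still bounds
      all rows.\<close>
    have "y \<le> x" if "y \<in> set ys" for y
      using set_in_young[OF ys(1) that] young_le[OF _ le] unfolding ys(2) by blast
    then have "x # ys \<in> partitions"
      using x ys by (auto simp: Cons_partitions)
    moreover have "young (x # ys) = young (x # xs) - {(i, j)}"
      using 2 by (auto simp: i' ys(2) young_Cons_iff)
    ultimately show ?thesis by (rule bexI[rotated])
  qed
qed

text \<open>Diagrams are closed upwards and to the left, so a box below or to the right of a removed
  box cannot remain. The converse is \<open>inner_cornersI\<close>.\<close>

lemma inner_corners_iff:
  assumes "xs \<in> partitions"
  shows "(i, j) \<in> inner_corners xs \<longleftrightarrow>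
    (i, j) \<in> young xs \<and> (Suc i, j) \<notin> young xs \<and> (i, Suc j) \<notin> young xs"
proof
  assume "(i, j) \<in> inner_corners xs"
  then obtain ys where ij: "(i, j) \<in> young xs"
    and ys: "ys \<in> partitions" "young ys = young xs - {(i, j)}"
    by (auto simp: inner_corners_def)
  have "1 \<le> i" "1 \<le> j" using ij by (auto simp: young_def)
  then have "(Suc i, j) \<notin> young ys" "(i, Suc j) \<notin> young ys"
    using young_up_closed[OF ys(1), of i j] young_left_closed[of i j ys] ys(2) by auto
  then show "(i, j) \<in> young xs \<and> (Suc i, j) \<notin> young xs \<and> (i, Suc j) \<notin> young xs"
    using ij ys(2) by auto
next
  assume "(i, j) \<in> young xs \<and> (Suc i, j) \<notin> young xs \<and> (i, Suc j) \<notin> young xs"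
  then show "(i, j) \<in> inner_corners xs"
    using inner_cornersI[OF assms, of i j] by (auto simp: inner_corners_def)
qed

text \<open>The end of the first row is a corner iff the next row is shorter or absent. Equal
  adjacent rows are exactly those with consecutive first-column hooks.\<close>

lemma inner_corners_Cons:
  assumes "x # xs \<in> partitions"
  shows "inner_corners (x # xs) =
    (if x + length xs - 1 \<in> first_hooks xs then {} else {(1, x)}) \<union>
    map_prod Suc id ` inner_corners xs"
proof -
  have le: "\<forall>y\<in>set xs. y \<le> x" and xs: "xs \<in> partitions" and x: "0 < x"
    using assms by (auto simp: Cons_partitions)
  have mem: "x + length xs - 1 \<in> first_hooks xs \<longleftrightarrow> (1, x) \<in> young xs"
  proof (cases xs)
    case (Cons y ys)
    have "\<forall>z\<in>set ys. z \<le> y" using xs Cons by (auto simp: Cons_partitions)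
    then have "x + length ys \<notin> first_hooks ys" if "y \<le> x"
      using first_hooks_less[of ys y "x + length ys"] that by auto
    then show ?thesis using Cons le x by auto
  qed simp
  have Suc_iff: "(Suc i, j) \<in> inner_corners (x # xs) \<longleftrightarrow> (i, j) \<in> inner_corners xs"
    if "1 \<le> i" for i j
    using that by (simp add: inner_corners_iff assms xs)
  have one_iff: "(Suc 0, j) \<in> inner_corners (x # xs) \<longleftrightarrow> j = x \<and> (1, x) \<notin> young xs" for j
    using x by (auto simp: inner_corners_iff assms not_less_eq_eq le_antisym)
  have zero: "(0, j) \<notin> inner_corners ys" for j ys
    by (simp add: inner_corners_def)
  show ?thesis
  proof (intro set_eqI)
    fix p :: "nat \<times> nat"
    obtain i j where p: "p = (i, j)" by fastforce
    consider "i = 0" | "i = Suc 0" | i' where "i = Suc i'" "1 \<le> i'"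
      by (cases i; cases "i - 1") auto
    then show "p \<in> inner_corners (x # xs) \<longleftrightarrow>
      p \<in> (if x + length xs - 1 \<in> first_hooks xs then {} else {(1, x)}) \<union>
        map_prod Suc id ` inner_corners xs"
      unfolding mem by cases (auto simp: p one_iff Suc_iff zero map_prod_def)
  qed
qed

lemma card_inner_corners:
  "xs \<in> partitions \<Longrightarrow>
    finite (inner_corners xs) \<and>
    card (inner_corners xs) = card {b \<in> first_hooks xs. b - 1 \<notin> first_hooks xs}"
proof (induction xs)
  case Nil
  then show ?case by (simp add: inner_corners_def)
next
  case (Cons x xs)
  let ?b = "x + length xs"
  let ?C = "{b \<in> first_hooks xs. b - 1 \<notin> first_hooks xs}"
  have le: "\<forall>y\<in>set xs. y \<le> x" and xs: "xs \<in> partitions" and x: "0 < x"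
    using Cons.prems by (auto simp: Cons_partitions)
  have fin: "finite (inner_corners xs)" and IH: "card (inner_corners xs) = card ?C"
    using Cons.IH[OF xs] by auto
  have less: "b < ?b" if "b \<in> first_hooks xs" for b
    using first_hooks_less[OF le that] .
  \<comment> \<open>The new maximum \<open>?b\<close> is the predecessor of no smaller element, and
    \<open>?b - 1\<close> differs from \<open>?b\<close> because \<open>x > 0\<close>.\<close>
  have C: "{b \<in> first_hooks (x # xs). b - 1 \<notin> first_hooks (x # xs)} =
      (if ?b - 1 \<in> first_hooks xs then {} else {?b}) \<union> ?C"
    using less x by (auto; fastforce)
  have disj: "(1, x) \<notin> map_prod Suc id ` inner_corners xs" "?b \<notin> ?C"
    using less by (auto simp: inner_corners_def)
  have "card (map_prod Suc id ` inner_corners xs) = card (inner_corners xs)"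
    by (intro card_image inj_onI) auto
  then show ?case
    unfolding inner_corners_Cons[OF Cons.prems] C using disj fin IH by auto
qed

text \<open>The hook length at (1, 1) is the largest first-column hook; for the empty partition both
  sides are vacuous.\<close>

lemma hook_length_bound:
  assumes "xs \<in> partitions"
  shows "((1, 1) \<in> young xs \<longrightarrow> hook_length xs (1, 1) < n) \<longleftrightarrow> (\<forall>b\<in>first_hooks xs. b < n)"
proof (cases xs)
  case (Cons x ys)
  have le: "\<forall>y\<in>set ys. y \<le> x" and ys: "ys \<in> partitions" and x: "0 < x"
    using assms Cons by (auto simp: Cons_partitions)
  \<comment> \<open>No row is empty, so 0 is the first gap.\<close>
  have "gap ys 0 = 0"
    using partitions_pos[OF ys] by (auto simp: gap_def filter_empty_conv)
  then have "hook_length xs (1, 1) = x + length ys"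
    using hook_length_first_row[of 1 x ys] x Cons by simp
  then show ?thesis
    using Cons x first_hooks_less[OF le] by (auto intro: less_trans)
qed simp

section \<open>Cores and sequences\<close>

definition core_sets :: "nat \<Rightarrow> nat \<Rightarrow> nat \<Rightarrow> nat set set" where
  "core_sets t m k = {X. finite X \<and> 0 \<notin> X \<and> (\<forall>b\<in>X. t \<le> b \<longrightarrow> b - t \<in> X) \<and>
     card {b \<in> X. b - 1 \<notin> X} = m \<and> (\<forall>b\<in>X. b < k * t)}"

lemma bij_betw_first_hooks:
  assumes "1 \<le> t"
  shows "bij_betw first_hooks (core_partitions t m k) (core_sets t m k)"
  unfolding bij_betw_def
proof
  have mem: "xs \<in> core_partitions t m k \<longleftrightarrow> first_hooks xs \<in> core_sets t m k"
    if "xs \<in> partitions" for xs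
    using that is_core_iff[OF assms that] card_inner_corners[OF that]
      hook_length_bound[OF that, of "k * t"] zero_notin_first_hooks[OF that]
    by (simp add: core_partitions_def core_sets_def)
  have sub: "core_partitions t m k \<subseteq> partitions"
    by (auto simp: core_partitions_def)
  then show "inj_on first_hooks (core_partitions t m k)"
    using inj_on_first_hooks inj_on_subset by blast
  show "first_hooks ` core_partitions t m k = core_sets t m k"
  proof
    show "first_hooks ` core_partitions t m k \<subseteq> core_sets t m k"
      using mem sub by auto
    show "core_sets t m k \<subseteq> first_hooks ` core_partitions t m k"
    proof
      fix X assume X: "X \<in> core_sets t m k"
      then obtain xs where "xs \<in> partitions" "first_hooks xs = X"
        using first_hooks_surj[of X] by (auto simp: core_sets_def)
      then show "X \<in> first_hooks ` core_partitions t m k"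
        using X mem by auto
    qed
  qed
qed

text \<open>The \<open>t\<close>-abacus with all beads pushed down: for \<open>i < t\<close>, runner
  \<open>i\<close> carries beads at levels \<open>0\<close> to \<open>ns ! i - 1\<close>, and the
  bead on level \<open>j\<close> is the number \<open>i + j * t\<close>.\<close>

definition abacus :: "nat \<Rightarrow> nat list \<Rightarrow> nat set" where
  "abacus t ns = {b. b div t < ns ! (b mod t)}"

lemma mem_abacus: "i < t \<Longrightarrow> i + j * t \<in> abacus t ns \<longleftrightarrow> j < ns ! i"
  by (simp add: abacus_def)

lemma div_mod_cases:
  assumes "1 \<le> t"
  obtains i j where "i < t" "b = i + j * (t::nat)"
  using assms by (metis mod_less_divisor mod_div_mult_eq Suc_le_eq One_nat_def)

lemma abacus_bound:
  assumes "1 \<le> t"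
  shows "(\<forall>b\<in>abacus t ns. b < k * t) \<longleftrightarrow> (\<forall>i<t. ns ! i \<le> k)"
proof
  assume L: "\<forall>b\<in>abacus t ns. b < k * t"
  show "\<forall>i<t. ns ! i \<le> k"
  proof (intro allI impI)
    fix i assume "i < t"
    then have "i + k * t \<notin> abacus t ns" using L by force
    then show "ns ! i \<le> k" using \<open>i < t\<close> by (simp add: mem_abacus)
  qed
next
  assume R: "\<forall>i<t. ns ! i \<le> k"
  show "\<forall>b\<in>abacus t ns. b < k * t"
  proof
    fix b assume "b \<in> abacus t ns"
    then have "b div t < ns ! (b mod t)" by (simp add: abacus_def)
    also have "\<dots> \<le> k" using R assms by simp
    finally have "b div t < k" .
    then show "b < k * t"
      using assms by (simp add: div_less_iff_less_mult)
  qed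
qed

text \<open>For \<open>i \<ge> 1\<close> the element \<open>i + j * t\<close> is counted iff
  \<open>ns ! (i - 1) \<le> j < ns ! i\<close>, so runner \<open>i\<close> contributes the positive
  part of the difference, which is truncated subtraction. Runner 0 is empty, so no predecessor falls
  onto runner \<open>t - 1\<close> one level lower.\<close>

lemma card_abacus_corners:
  assumes t: "1 \<le> t" and ns: "ns ! 0 = 0"
  shows "card {b \<in> abacus t ns. b - 1 \<notin> abacus t ns} = (\<Sum>i=1..<t. ns ! i - ns ! (i - 1))"
proof -
  let ?A = "\<lambda>i. (\<lambda>j. i + j * t) ` {ns ! (i - 1)..<ns ! i}"
  have "{b \<in> abacus t ns. b - 1 \<notin> abacus t ns} = (\<Union>i\<in>{1..<t}. ?A i)"
  proof (intro set_eqI iffI)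
    fix b assume b: "b \<in> {b \<in> abacus t ns. b - 1 \<notin> abacus t ns}"
    obtain i j where ij: "i < t" "b = i + j * t"
      using div_mod_cases[OF t] .
    have "j < ns ! i" using b ij by (simp add: mem_abacus)
    then have "1 \<le> i" using ns by (cases i) auto
    then have "b - 1 = (i - 1) + j * t" using ij by simp
    then have "ns ! (i - 1) \<le> j"
      using b ij mem_abacus[of "i - 1" t j ns] by (auto simp: not_less)
    then show "b \<in> (\<Union>i\<in>{1..<t}. ?A i)"
      using ij \<open>1 \<le> i\<close> \<open>j < ns ! i\<close> by (intro UN_I[of i]) auto
  next
    fix b assume "b \<in> (\<Union>i\<in>{1..<t}. ?A i)"
    then obtain i j where ij: "1 \<le> i" "i < t" "ns ! (i - 1) \<le> j" "j < ns ! i" "b = i + j * t"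
      by auto
    then have "b - 1 = (i - 1) + j * t" by simp
    then show "b \<in> {b \<in> abacus t ns. b - 1 \<notin> abacus t ns}"
      using ij mem_abacus[of "i - 1" t j ns] by (simp add: mem_abacus)
  qed
  moreover have "card (\<Union>i\<in>{1..<t}. ?A i) = (\<Sum>i=1..<t. card (?A i))"
  proof (rule card_UN_disjoint)
    show "\<forall>i\<in>{1..<t}. \<forall>j\<in>{1..<t}. i \<noteq> j \<longrightarrow> ?A i \<inter> ?A j = {}"
    proof (intro ballI impI)
      fix i j assume "i \<in> {1..<t}" "j \<in> {1..<t}" "i \<noteq> j"
      moreover from this have "\<forall>b\<in>?A i. b mod t = i" "\<forall>b\<in>?A j. b mod t = j" by auto
      ultimately show "?A i \<inter> ?A j = {}" by (metis disjoint_iff)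
    qed
  qed auto
  moreover have "card (?A i) = ns ! i - ns ! (i - 1)" for i
    using t by (subst card_image) (auto intro!: inj_onI)
  ultimately show ?thesis by simp
qed

text \<open>An absolute value is twice the positive part minus the number itself, and the
  differences themselves telescope.\<close>

lemma sum_abs_diff:
  fixes f :: "nat \<Rightarrow> nat"
  shows "(\<Sum>i=1..n. \<bar>int (f i) - int (f (i - 1))\<bar>) =
    2 * int (\<Sum>i=1..n. f i - f (i - 1)) + int (f 0) - int (f n)"
  by (induction n) (auto simp: of_nat_diff)

text \<open>A sequence that starts and ends at 0 ascends as much as it descends, so its total
  variation is twice its total ascent.\<close>

lemma sequences_iff:
  assumes t: "1 \<le> t" and len: "length ns = t"
  shows "ns \<in> sequences t m k \<longleftrightarrow>
    ns ! 0 = 0 \<and> (\<forall>i<t. ns ! i \<le> k) \<and> (\<Sum>i=1..<t. ns ! i - ns ! (i - 1)) = m"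
proof -
  define f where "f = (\<lambda>i. (ns @ [0]) ! i)"
  have f: "f i = ns ! i" if "i < t" for i
    using that len by (simp add: f_def nth_append)
  have ft: "f t = 0" using len by (auto simp: f_def nth_append)
  \<comment> \<open>The last difference leads to \<open>f t = 0\<close>, so its positive part
    vanishes.\<close>
  have "{1..t} = insert t {1..<t}" using t by auto
  then have "(\<Sum>i=1..t. f i - f (i - 1)) = (\<Sum>i=1..<t. f i - f (i - 1))"
    using ft by simp
  also have "\<dots> = (\<Sum>i=1..<t. ns ! i - ns ! (i - 1))"
    by (intro sum.cong) (auto simp: f)
  finally have S: "(\<Sum>i=1..t. \<bar>int (f i) - int (f (i - 1))\<bar>) =
      2 * int (\<Sum>i=1..<t. ns ! i - ns ! (i - 1)) + int (f 0)"
    using sum_abs_diff[of f t] ft by simp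
  have "ns \<in> sequences t m k \<longleftrightarrow> f 0 = 0 \<and> (\<forall>i<t. f i \<le> k) \<and>
      (\<Sum>i=1..t. \<bar>int (f i) - int (f (i - 1))\<bar>) = 2 * int m"
    unfolding sequences_def f_def Let_def using len by simp
  also have "\<dots> \<longleftrightarrow> ns ! 0 = 0 \<and> (\<forall>i<t. ns ! i \<le> k) \<and> (\<Sum>i=1..<t. ns ! i - ns ! (i - 1)) = m"
    unfolding S using f t by (auto simp del: of_nat_sum)
  finally show ?thesis .
qed

lemma abacus_core_sets_iff:
  assumes t: "1 \<le> t" and len: "length ns = t"
  shows "abacus t ns \<in> core_sets t m k \<longleftrightarrow> ns \<in> sequences t m k"
proof -
  \<comment> \<open>Finiteness comes from \<open>abacus_bound\<close> with the largest entry in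
    place of \<open>k\<close>.\<close>
  have "\<forall>i<t. ns ! i \<le> Max (set ns)"
    using len by simp
  then have "\<forall>b\<in>abacus t ns. b < Max (set ns) * t"
    using abacus_bound[OF t] by blast
  then have fin: "finite (abacus t ns)"
    by (metis bounded_nat_set_is_finite)
  have zero: "0 \<notin> abacus t ns \<longleftrightarrow> ns ! 0 = 0"
    by (simp add: abacus_def)
  have down: "\<forall>b\<in>abacus t ns. t \<le> b \<longrightarrow> b - t \<in> abacus t ns"
    using t by (auto simp: abacus_def le_mod_geq le_div_geq)
  show ?thesis
    unfolding core_sets_def sequences_iff[OF t len]
    using fin zero down abacus_bound[OF t] card_abacus_corners[OF t] by auto
qed

section \<open>Reading the sequence off a core set\<close>

lemma down_closed_nat:
  fixes S :: "nat set"
  assumes "finite S" "\<And>j. Suc j \<in> S \<Longrightarrow> j \<in> S"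
  shows "\<exists>n. S = {..<n}"
proof -
  have closed: "i \<in> S" if "i \<le> j" "j \<in> S" for i j
    using that by (induction j rule: dec_induct) (simp_all add: assms(2))
  show ?thesis
  proof (cases "S = {}")
    case True
    then show ?thesis by (intro exI[of _ 0]) simp
  next
    case False
    then have "Max S \<in> S" using assms(1) by simp
    then have "j \<in> S \<longleftrightarrow> j < Suc (Max S)" for j
      using closed[of j "Max S"] Max_ge[OF assms(1), of j] unfolding less_Suc_eq_le by iprover
    then show ?thesis by (intro exI[of _ "Suc (Max S)"] set_eqI) simp
  qed
qed

lemma bij_betw_abacus:
  assumes t: "1 \<le> t"
  shows "bij_betw (abacus t) (sequences t m k) (core_sets t m k)"
  unfolding bij_betw_def
proof
  show "inj_on (abacus t) (sequences t m k)"
  proof (rule inj_onI)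
    fix ns ms assume a: "ns \<in> sequences t m k" "ms \<in> sequences t m k" "abacus t ns = abacus t ms"
    then have len: "length ns = t" "length ms = t" by (auto simp: sequences_def)
    have "ns ! i = ms ! i" if "i < t" for i
      using mem_abacus[OF that, of _ ns] mem_abacus[OF that, of _ ms] a(3)
      by (metis less_irrefl nat_neq_iff)
    then show "ns = ms" using len by (simp add: list_eq_iff_nth_eq)
  qed
  show "abacus t ` sequences t m k = core_sets t m k"
  proof
    show "abacus t ` sequences t m k \<subseteq> core_sets t m k"
      using abacus_core_sets_iff[OF t] by (auto simp: sequences_def)
    show "core_sets t m k \<subseteq> abacus t ` sequences t m k"
    proof
      fix X assume X: "X \<in> core_sets t m k"
      \<comment> \<open>Closure under subtracting \<open>t\<close> makes the levels occupied on
        runner \<open>i\<close> an initial segment; its length is the entry at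
        \<open>i\<close>.\<close>
      have "\<exists>n. {j. i + j * t \<in> X} = {..<n}" for i
      proof (rule down_closed_nat)
        have "inj_on (\<lambda>j. i + j * t) {j. i + j * t \<in> X}"
          using t by (auto intro: inj_onI)
        moreover have "(\<lambda>j. i + j * t) ` {j. i + j * t \<in> X} \<subseteq> X" by auto
        ultimately show "finite {j. i + j * t \<in> X}"
          using X inj_on_finite by (fastforce simp: core_sets_def)
        fix j assume "Suc j \<in> {j. i + j * t \<in> X}"
        then have "i + Suc j * t - t \<in> X"
          using X by (auto simp: core_sets_def)
        then show "j \<in> {j. i + j * t \<in> X}" by simp
      qed
      then obtain n where n: "\<And>i. {j. i + j * t \<in> X} = {..<n i}" by metis
      have "X = abacus t (map n [0..<t])"
      proof (rule set_eqI)
        fix b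
        obtain i j where ij: "i < t" "b = i + j * t"
          using div_mod_cases[OF t] .
        then show "b \<in> X \<longleftrightarrow> b \<in> abacus t (map n [0..<t])"
          using n[of i] by (auto simp: mem_abacus)
      qed
      then show "X \<in> abacus t ` sequences t m k"
        using X abacus_core_sets_iff[OF t, of "map n [0..<t]"] by auto
    qed
  qed
qed

section \<open>Sequences and paths\<close>

definition climb :: "nat \<Rightarrow> nat \<Rightarrow> step list" where
  "climb a b = replicate (b - a) Up @ replicate (a - b) Down"

text \<open>The list holds the heights of the flat steps, and \<open>a\<close> is the starting
  height. The last block descends to the axis.\<close>

fun path_of :: "nat \<Rightarrow> nat list \<Rightarrow> step list" where
  "path_of a [] = climb a 0"
| "path_of a (n # ns) = climb a n @ Flat # path_of n ns"

fun flat_heights :: "nat \<Rightarrow> step list \<Rightarrow> nat list" where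
  "flat_heights a [] = []"
| "flat_heights a (Up # p) = flat_heights (Suc a) p"
| "flat_heights a (Down # p) = flat_heights (a - 1) p"
| "flat_heights a (Flat # p) = a # flat_heights a p"

text \<open>A recursive test with natural numbers as heights for a path from height \<open>a\<close>
  to 0 within the strip; \<open>strip_walk_iff\<close> links it to vertices.\<close>

fun strip_walk :: "nat \<Rightarrow> nat \<Rightarrow> step list \<Rightarrow> bool" where
  "strip_walk k a [] \<longleftrightarrow> a = 0"
| "strip_walk k a (Up # p) \<longleftrightarrow> a < k \<and> strip_walk k (Suc a) p"
| "strip_walk k a (Down # p) \<longleftrightarrow> 0 < a \<and> strip_walk k (a - 1) p"
| "strip_walk k a (Flat # p) \<longleftrightarrow> strip_walk k a p"

text \<open>The total variation of \<open>a # ns\<close> followed by a final 0.\<close>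

fun variation :: "nat \<Rightarrow> nat list \<Rightarrow> int" where
  "variation a [] = int a"
| "variation a (n # ns) = \<bar>int n - int a\<bar> + variation n ns"

section \<open>Vertices and the recursive description of strip paths\<close>

lemma vertex_0 [simp]: "vertex p 0 = 0"
  by (simp add: vertex_def)

lemma vertex_Cons_Suc [simp]: "vertex (s # p) (Suc i) = step_vec s + vertex p i"
  by (simp add: vertex_def)

lemma fst_vertex: "i \<le> length p \<Longrightarrow> fst (vertex p i) = int i"
proof (induction p arbitrary: i)
  case (Cons s p)
  then show ?case by (cases i; cases s) auto
qed simp

lemma strip_walk_iff:
  "a \<le> k \<Longrightarrow> strip_walk k a p \<longleftrightarrow> int a + snd (vertex p (length p)) = 0 \<and>
    (\<forall>i\<le>length p. 0 \<le> int a + snd (vertex p i) \<and> int a + snd (vertex p i) \<le> int k)"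
proof (induction p arbitrary: a)
  case Nil
  then show ?case by auto
next
  case (Cons s p)
  \<comment> \<open>Splitting off the initial vertex lets \<open>vertex_Cons_Suc\<close> reduce the
    others to the tail of the path.\<close>
  have all: "(\<forall>i\<le>Suc n. P i) \<longleftrightarrow> P 0 \<and> (\<forall>i\<le>n. P (Suc i))" for n and P :: "nat \<Rightarrow> bool"
    by (metis Suc_le_mono le0 not0_implies_Suc)
  show ?case
  proof (cases s)
    case Up
    show ?thesis
    proof (cases "a < k")
      case True
      then show ?thesis
        using Cons.IH[of "Suc a"] Up by (simp add: all algebra_simps)
    next
      case False
      \<comment> \<open>Here \<open>a = k\<close>, so the first step already leaves the
        strip.\<close>
      then have "\<not> int a + snd (vertex (s # p) 1) \<le> int k"
        using Up by simp
      then show ?thesis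
        using False Up by force
    qed
  next
    case Down
    show ?thesis
    proof (cases "0 < a")
      case True
      then show ?thesis
        using Cons.IH[of "a - 1"] Cons.prems Down by (simp add: all algebra_simps of_nat_diff)
    next
      case False
      then have "\<not> 0 \<le> int a + snd (vertex (s # p) 1)"
        using Down by simp
      then show ?thesis
        using False Down by force
    qed
  next
    case Flat
    then show ?thesis
      using Cons.IH[of a] Cons.prems by (simp add: all)
  qed
qed

lemma strip_paths_iff:
  "p \<in> strip_paths t m k \<longleftrightarrow>
    length p = 2 * m + t - 1 \<and> strip_walk k 0 p \<and> cornerless p \<and> count_list p Flat = t - 1"
  unfolding strip_paths_def motzkin_paths_def in_strip_def
  using strip_walk_iff[of 0 k p] fst_vertex[of "length p" p] by (auto simp: prod_eq_iff)

text \<open>Covers peaks and valleys alike, by the choice of \<open>a\<close> and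
  \<open>b\<close>.\<close>

lemma consecutive_Cons:
  "(\<exists>i. Suc i < length (s # p) \<and> (s # p) ! i = a \<and> (s # p) ! Suc i = b) \<longleftrightarrow>
    (s = a \<and> p \<noteq> [] \<and> hd p = b) \<or> (\<exists>i. Suc i < length p \<and> p ! i = a \<and> p ! Suc i = b)"
  (is "?L \<longleftrightarrow> ?R")
proof
  assume ?L
  then obtain i where "Suc i < length (s # p) \<and> (s # p) ! i = a \<and> (s # p) ! Suc i = b" by blast
  then show ?R by (cases i) (auto simp: hd_conv_nth)
next
  assume ?R
  then show ?L
    by (elim disjE exE) (force simp: hd_conv_nth intro: exI[of _ 0], metis Suc_less_eq length_Cons nth_Cons_Suc)
qed

section \<open>Cornerless paths and their monotone blocks\<close>

lemma cornerless_Nil [simp]: "cornerless []"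
  by (simp add: cornerless_def has_peak_def has_valley_def)

lemma cornerless_Cons:
  "cornerless (s # p) \<longleftrightarrow> cornerless p \<and>
    (p \<noteq> [] \<longrightarrow> \<not> (s = Up \<and> hd p = Down) \<and> \<not> (s = Down \<and> hd p = Up))"
  unfolding cornerless_def has_peak_def has_valley_def consecutive_Cons by blast

text \<open>A constant run contains no corner, and a flat step after it creates none.\<close>

lemma cornerless_replicate_append:
  assumes "cornerless p" "p \<noteq> [] \<Longrightarrow> hd p = Flat"
  shows "cornerless (replicate n s @ p)"
proof (induction n)
  case (Suc n)
  then show ?case using assms(2) by (cases n) (auto simp: cornerless_Cons)
qed (use assms in simp)

lemma cornerless_climb_append:
  assumes "cornerless p" "p \<noteq> [] \<Longrightarrow> hd p = Flat"
  shows "cornerless (climb a b @ p)"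
  using cornerless_replicate_append[OF assms] by (cases "a \<le> b") (auto simp: climb_def)

lemma cornerless_path_of: "cornerless (path_of a ns)"
proof (induction ns arbitrary: a)
  case Nil
  then show ?case using cornerless_climb_append[of "[]"] by simp
next
  case (Cons n ns)
  then show ?case by (auto intro: cornerless_climb_append simp: cornerless_Cons)
qed

lemma strip_walk_ups: "a + n \<le> k \<Longrightarrow> strip_walk k a (replicate n Up @ p) \<longleftrightarrow> strip_walk k (a + n) p"
  by (induction n arbitrary: a) auto

lemma strip_walk_downs: "n \<le> a \<Longrightarrow> strip_walk k a (replicate n Down @ p) \<longleftrightarrow> strip_walk k (a - n) p"
  by (induction n arbitrary: a) auto

text \<open>A block is monotone: its up steps end at or below \<open>b \<le> k\<close>, and its down
  steps start above \<open>b\<close>.\<close>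

lemma strip_walk_climb: "b \<le> k \<Longrightarrow> strip_walk k a (climb a b @ p) \<longleftrightarrow> strip_walk k b p"
  by (cases "a \<le> b") (auto simp: climb_def strip_walk_ups strip_walk_downs)

lemma strip_walk_path_of: "\<forall>n\<in>set ns. n \<le> k \<Longrightarrow> strip_walk k a (path_of a ns)"
  by (induction ns arbitrary: a) (use strip_walk_climb[of 0 k _ "[]"] in \<open>auto simp: strip_walk_climb\<close>)

lemma flat_heights_ups: "flat_heights a (replicate n Up @ p) = flat_heights (a + n) p"
  by (induction n arbitrary: a) auto

lemma flat_heights_downs: "flat_heights a (replicate n Down @ p) = flat_heights (a - n) p"
  by (induction n arbitrary: a) auto

lemma flat_heights_climb: "flat_heights a (climb a b @ p) = flat_heights b p"
  by (cases "a \<le> b") (auto simp: climb_def flat_heights_ups flat_heights_downs)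

lemma flat_heights_path_of: "flat_heights a (path_of a ns) = ns"
  by (induction ns arbitrary: a) (use flat_heights_climb[of _ 0 "[]"] in \<open>auto simp: flat_heights_climb\<close>)

text \<open>Each unit of variation costs one up or down step, and each entry one flat step.\<close>

lemma length_path_of: "int (length (path_of a ns)) = variation a ns + int (length ns)"
  by (induction ns arbitrary: a) (auto simp: climb_def)

lemma count_list_replicate: "count_list (replicate n s) x = (if s = x then n else 0)"
  by (induction n) auto

lemma count_Flat_path_of: "count_list (path_of a ns) Flat = length ns"
  by (induction ns arbitrary: a) (auto simp: climb_def count_list_replicate)

lemma length_flat_heights: "length (flat_heights a p) = count_list p Flat"
  by (induction a p rule: flat_heights.induct) auto

lemma flat_heights_le: "strip_walk k a p \<Longrightarrow> a \<le> k \<Longrightarrow> n \<in> set (flat_heights a p) \<Longrightarrow> n \<le> k"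
  by (induction k a p rule: strip_walk.induct) auto

text \<open>The hypothesis says that a leading up step creates no peak. The first block from
  \<open>Suc a\<close> then does not descend, and the block from \<open>a\<close> is the same one
  with one more up step.\<close>

lemma path_of_Suc:
  assumes "path_of (Suc a) ns \<noteq> [] \<Longrightarrow> hd (path_of (Suc a) ns) \<noteq> Down"
  shows "path_of a ns = Up # path_of (Suc a) ns"
proof -
  \<comment> \<open>The target \<open>b\<close> of the first block is the height of the first flat
    step, or 0 if there is none; the rest \<open>q\<close> does not depend on the starting
    height.\<close>
  define b where "b = (case ns of [] \<Rightarrow> 0 | n # _ \<Rightarrow> n)"
  define q where "q = (case ns of [] \<Rightarrow> [] | n # ns' \<Rightarrow> Flat # path_of n ns')"
  have path: "path_of c ns = climb c b @ q" for c
    by (cases ns) (auto simp: b_def q_def)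
  have "Suc a \<le> b"
  proof (rule ccontr)
    assume "\<not> Suc a \<le> b"
    then have "climb (Suc a) b = Down # replicate (a - b) Down"
      by (simp add: climb_def Suc_diff_le)
    then show False using assms unfolding path by simp
  qed
  then have "climb a b = Up # climb (Suc a) b"
    by (simp add: climb_def flip: replicate_Suc)
  then show ?thesis unfolding path by simp
qed

text \<open>The mirror image of \<open>path_of_Suc\<close>, with a valley in place of a
  peak.\<close>

lemma path_of_pred:
  assumes "path_of a ns \<noteq> [] \<Longrightarrow> hd (path_of a ns) \<noteq> Up"
  shows "path_of (Suc a) ns = Down # path_of a ns"
proof -
  define b where "b = (case ns of [] \<Rightarrow> 0 | n # _ \<Rightarrow> n)"
  define q where "q = (case ns of [] \<Rightarrow> [] | n # ns' \<Rightarrow> Flat # path_of n ns')"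
  have path: "path_of c ns = climb c b @ q" for c
    by (cases ns) (auto simp: b_def q_def)
  have "b \<le> a"
  proof (rule ccontr)
    assume "\<not> b \<le> a"
    then have "climb a b = Up # replicate (b - Suc a) Up"
      by (simp add: climb_def flip: replicate_Suc)
    then show False using assms unfolding path by simp
  qed
  then have "climb (Suc a) b = Down # climb a b"
    by (simp add: climb_def Suc_diff_le)
  then show ?thesis unfolding path by simp
qed

text \<open>Between consecutive flat steps a cornerless path only rises or only falls, so the flat
  heights determine it. In the induction, cornerlessness supplies the hypotheses of
  \<open>path_of_Suc\<close> and \<open>path_of_pred\<close>.\<close>

lemma path_of_flat_heights:
  "strip_walk k a p \<Longrightarrow> cornerless p \<Longrightarrow> path_of a (flat_heights a p) = p"
proof (induction k a p rule: strip_walk.induct)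
  case (1 k a)
  then show ?case by (simp add: climb_def)
next
  case (2 k a p)
  then have "path_of (Suc a) (flat_heights (Suc a) p) = p"
    by (simp add: cornerless_Cons)
  then show ?case
    using path_of_Suc[of a "flat_heights (Suc a) p"] 2 by (auto simp: cornerless_Cons)
next
  case (3 k a p)
  then have "path_of (a - 1) (flat_heights (a - 1) p) = p"
    by (simp add: cornerless_Cons)
  then show ?case
    \<comment> \<open>The walk condition gives \<open>0 < a\<close>, so \<open>Suc (a - 1)\<close>
      is \<open>a\<close>.\<close>
    using path_of_pred[of "a - 1" "flat_heights (a - 1) p"] 3 by (auto simp: cornerless_Cons)
next
  case (4 k a p)
  then show ?case by (simp add: cornerless_Cons climb_def)
qed

section \<open>Sequences as lists of flat heights\<close>

lemma variation_eq_sum: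
  "(\<Sum>i=1..length (a # ns). \<bar>int ((a # ns @ [0]) ! i) - int ((a # ns @ [0]) ! (i - 1))\<bar>) =
    variation a ns"
proof (induction ns arbitrary: a)
  case (Cons n ns)
  show ?case
    using Cons.IH[of n] unfolding One_nat_def sum.atLeast1_atMost_eq
    by (simp add: sum.lessThan_Suc_shift del: sum.lessThan_Suc)
qed simp

text \<open>Splits off the fixed first entry 0; the other \<open>t - 1\<close> entries become the
  heights of the \<open>t - 1\<close> flat steps.\<close>

lemma sequences_Cons:
  assumes "1 \<le> t"
  shows "ns \<in> sequences t m k \<longleftrightarrow>
    (\<exists>ms. ns = 0 # ms \<and> length ms = t - 1 \<and> (\<forall>n\<in>set ms. n \<le> k) \<and> variation 0 ms = 2 * int m)"
proof (cases ns)
  case Nil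
  then show ?thesis using assms by (auto simp: sequences_def)
next
  case (Cons a ms)
  show ?thesis
  proof (cases "length ms = t - 1")
    case True
    then have t: "t = length (a # ms)" using assms by simp
    have le: "(\<forall>i<t. (ns @ [0]) ! i \<le> k) \<longleftrightarrow> (\<forall>n\<in>set ns. n \<le> k)"
      using Cons t by (simp add: nth_append all_set_conv_all_nth del: append_Cons set_simps)
    have sum: "(\<Sum>i=1..t. \<bar>int ((ns @ [0]) ! i) - int ((ns @ [0]) ! (i - 1))\<bar>) = variation a ms"
      using variation_eq_sum[of a ms] unfolding Cons t by simp
    have "length ns = t" using Cons t by simp
    then show ?thesis
      unfolding sequences_def Let_def mem_Collect_eq le sum using Cons True by auto
  next
    case False
    then show ?thesis using Cons assms by (auto simp: sequences_def)
  qed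
qed

lemma bij_betw_path_of:
  assumes "1 \<le> t"
  shows "bij_betw (\<lambda>ns. path_of 0 (tl ns)) (sequences t m k) (strip_paths t m k)"
proof (rule bij_betw_byWitness[where f' = "\<lambda>p. 0 # flat_heights 0 p"])
  show "\<forall>ns\<in>sequences t m k. 0 # flat_heights 0 (path_of 0 (tl ns)) = ns"
    by (auto simp: sequences_Cons[OF assms] flat_heights_path_of)
  show "\<forall>p\<in>strip_paths t m k. path_of 0 (tl (0 # flat_heights 0 p)) = p"
    by (auto simp: strip_paths_iff path_of_flat_heights)
  show "(\<lambda>ns. path_of 0 (tl ns)) ` sequences t m k \<subseteq> strip_paths t m k"
  proof (rule image_subsetI)
    fix ns assume "ns \<in> sequences t m k"
    then obtain ms where ms: "ns = 0 # ms" "length ms = t - 1" "\<forall>n\<in>set ms. n \<le> k"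
        "variation 0 ms = 2 * int m"
      by (auto simp: sequences_Cons[OF assms])
    then have "length (path_of 0 ms) = 2 * m + t - 1"
      using length_path_of[of 0 ms] assms by simp
    then show "path_of 0 (tl ns) \<in> strip_paths t m k"
      using ms by (simp add: strip_paths_iff strip_walk_path_of cornerless_path_of count_Flat_path_of)
  qed
  show "(\<lambda>p. 0 # flat_heights 0 p) ` strip_paths t m k \<subseteq> sequences t m k"
  proof (rule image_subsetI)
    fix p assume p: "p \<in> strip_paths t m k"
    then have "path_of 0 (flat_heights 0 p) = p"
      by (auto simp: strip_paths_iff path_of_flat_heights)
    then have "int (length p) = variation 0 (flat_heights 0 p) + int (count_list p Flat)"
      using length_path_of[of 0 "flat_heights 0 p"] by (simp add: length_flat_heights)
    then have "variation 0 (flat_heights 0 p) = 2 * int m"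
      using p assms by (simp add: strip_paths_iff)
    then show "0 # flat_heights 0 p \<in> sequences t m k"
      using p flat_heights_le[of k 0 p] by (auto simp: sequences_Cons[OF assms] strip_paths_iff length_flat_heights)
  qed
qed

section \<open>The degenerate case \<open>t = 0\<close>\<close>

lemma core_partitions_0: "core_partitions 0 m k = (if m = 0 then {[]} else {})"
proof -
  \<comment> \<open>A nonempty partition contains the box (1, 1), whose hook length is not below
    \<open>k * 0\<close>.\<close>
  have "xs = []" if "xs \<in> core_partitions 0 m k" for xs
    using that by (cases xs) (auto simp: core_partitions_def Cons_partitions)
  moreover have "[] \<in> core_partitions 0 m k \<longleftrightarrow> m = 0"
    by (auto simp: core_partitions_def inner_corners_def is_core_def)
  ultimately show ?thesis by auto
qed

lemma sequences_0: "sequences 0 m k = (if m = 0 then {[]} else {})"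
  by (auto simp: sequences_def)

lemma strip_paths_0: "strip_paths 0 m k = (if m = 0 then {[]} else {})"
proof -
  have "p = []" if "p \<in> strip_paths 0 m k" for p
  proof -
    \<comment> \<open>By truncation there are \<open>0 - 1 = 0\<close> flat steps, so the path is
      the single block from 0 to 0, which is empty.\<close>
    have "flat_heights 0 p = []"
      using that length_flat_heights[of 0 p] by (simp add: strip_paths_iff)
    moreover have "path_of 0 (flat_heights 0 p) = p"
      using that by (intro path_of_flat_heights[of k]) (auto simp: strip_paths_iff)
    ultimately show ?thesis by (simp add: climb_def)
  qed
  then show ?thesis by (force simp: strip_paths_iff)
qed

theorem theorem3p3:
  fixes t m k :: nat
  shows "(\<exists>f. bij_betw f (core_partitions t m k) (sequences t m k)) \<and>
         (\<exists>g. bij_betw g (sequences t m k) (strip_paths t m k)) \<and>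
         (\<exists>h. bij_betw h (core_partitions t m k) (strip_paths t m k))"
proof -
  have "(\<exists>f. bij_betw f (core_partitions t m k) (sequences t m k)) \<and>
        (\<exists>g. bij_betw g (sequences t m k) (strip_paths t m k))"
  proof (cases "t = 0")
    case True
    show ?thesis
      unfolding core_partitions_0 sequences_0 strip_paths_0 True
      by (intro conjI exI[of _ "\<lambda>_. []"]) (simp_all add: bij_betw_def)
  next
    case False
    then have "1 \<le> t" by simp
    \<comment> \<open>Partitions and sequences meet in \<open>core_sets\<close>:
      \<open>first_hooks\<close> is followed by the inverse of \<open>abacus\<close>.\<close>
    then show ?thesis
      using bij_betw_first_hooks bij_betw_abacus bij_betw_path_of
      by (meson bij_betw_inv_into bij_betw_trans)
  qed
  then show ?thesis by (meson bij_betw_trans)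
qed

end
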